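(* Let $f:\{0,1\}^2\to\{0,1\}$ be a Boolean function of two variables. Then $ess(f)=2$ and $gap(f)=2$ (i.e. $f\in G_2^2$) if and only if there are $a_0,a_1,a_2\in\{0,1\}$ with $a_1\neq a_0$ or $a_2\neq a_0$ such that $$f=a_0\cdot(x_1^0x_2^0\oplus x_1^1x_2^1)\oplus a_1\cdot x_1^0x_2^1\oplus a_2\cdot x_1^1x_2^0.$$
   Context: $B=\{0,1\}$ is the ring of residues modulo $2$, with addition $\oplus$ and multiplication modulo $2$. $P_2^n$ is the set of all functions $f:B^n\to B$, with variables $x_1,\ldots,x_n$. For $\alpha\in B$, $x^\alpha=1$ if $x=\alpha$ and $x^\alpha=0$ otherwise. A variable $x_i$ is essential in $f$ if changing the $i$-th argument alone changes the value of $f$ at some point; $Ess(f)$ is the set of essential variables and $ess(f)=|Ess(f)|$. For $i\neq j$, the identification minor $f_{i\leftarrow j}$ is the function obtained from $f$ by substituting $x_j$ for $x_i$ (regarded as a function of $x_1,\ldots,x_n$). The essential arity gap is $gap(f)=ess(f)-\max ess(f_{i\leftarrow j})$, the maximum being over all pairs of distinct essential variables $x_i,x_j$ of $f$. $G_2^2$ is the set of $f\in P_2^2$ with $ess(f)=2$ and $gap(f)=2$. *)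

theory Defs
  imports "HOL-Analysis.Finite_Cartesian_Product" "HOL-Library.Z2"
begin

text \<open>The ring of residues modulo 2 is the type \<^typ>\<open>bit\<close>, whose addition is exclusive or.
  A Boolean function of \<open>n\<close> variables is a function \<open>bit ^ 'n \<Rightarrow> bit\<close> with \<open>CARD('n) = n\<close>.\<close>

definition Ess :: "(bit ^ 'n \<Rightarrow> bit) \<Rightarrow> 'n set" where
  "Ess f = {i. \<exists>x y. (\<forall>k. k \<noteq> i \<longrightarrow> x $ k = y $ k) \<and> f x \<noteq> f y}"

definition ess :: "(bit ^ 'n \<Rightarrow> bit) \<Rightarrow> nat" where
  "ess f = card (Ess f)"

definition minor :: "(bit ^ 'n \<Rightarrow> bit) \<Rightarrow> 'n \<Rightarrow> 'n \<Rightarrow> bit ^ 'n \<Rightarrow> bit" where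
  "minor f i j = (\<lambda>x. f (\<chi> k. if k = i then x $ j else x $ k))"

text \<open>The set under \<^const>\<open>Max\<close> is nonempty exactly when \<open>f\<close> has at least two essential
  variables; otherwise \<open>gap f\<close> is unspecified.\<close>

definition gap :: "(bit ^ 'n \<Rightarrow> bit) \<Rightarrow> int" where
  "gap f = int (ess f) -
     int (Max {ess (minor f i j) | i j. i \<in> Ess f \<and> j \<in> Ess f \<and> i \<noteq> j})"

text \<open>\<open>lit x \<alpha>\<close> is the literal usually written as a power of \<open>x\<close> with exponent \<open>\<alpha>\<close>.\<close>

definition lit :: "bit \<Rightarrow> bit \<Rightarrow> bit" where
  "lit x \<alpha> = (if x = \<alpha> then 1 else 0)"

text \<open>In the index type \<open>2\<close> the numeral \<open>2\<close> denotes \<open>0\<close>, so the indices \<open>1\<close> and \<open>2\<close> are its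
  two distinct elements.\<close>

definition G22 :: "(bit ^ 2 \<Rightarrow> bit) set" where
  "G22 = {f. ess f = 2 \<and> gap f = 2}"

end

theory Submission
  imports Defs "HOL-Analysis.Cartesian_Space"
begin

text \<open>Both identification minors depend on a single variable and take the values \<open>f(0,0)\<close> and
  \<open>f(1,1)\<close>. Hence, when both variables of \<open>f\<close> are essential, the gap is \<open>2\<close> exactly
  when \<open>f(0,0) = f(1,1)\<close>.\<close>

definition pair :: "bit \<Rightarrow> bit \<Rightarrow> bit ^ 2" where
  "pair a b = (\<chi> k. if k = 1 then a else b)"

lemma pair_nth [simp]: "pair a b $ 1 = a" "pair a b $ 2 = b"
  by (simp_all add: pair_def)

lemma pair_nth_nth [simp]: "pair (x $ 1) (x $ 2) = x"
  by (simp add: vec_eq_iff forall_2)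

text \<open>Together with \<open>all_bit\<close>, this turns a quantifier over points into a finite
  check at the four corners of the square.\<close>

lemma all_pair: "(\<forall>x. P x) \<longleftrightarrow> (\<forall>a b. P (pair a b))"
  by (metis pair_nth_nth)

lemma ex_pair: "(\<exists>x. P x) \<longleftrightarrow> (\<exists>a b. P (pair a b))"
  by (metis pair_nth_nth)

lemma all_bit: "(\<forall>a::bit. P a) \<longleftrightarrow> P 0 \<and> P 1"
  by (metis bit.exhaust)

lemma ex_bit: "(\<exists>a::bit. P a) \<longleftrightarrow> P 0 \<or> P 1"
  by (metis bit.exhaust)

text \<open>Points that agree off one coordinate but have different values under \<open>f\<close>
  are the two ends of an edge of the square in that direction, and each direction has just two
  edges.\<close>

lemma mem_Ess_iff:
  fixes f :: "bit ^ 2 \<Rightarrow> bit"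
  shows "1 \<in> Ess f \<longleftrightarrow> f (pair 0 0) \<noteq> f (pair 1 0) \<or> f (pair 0 1) \<noteq> f (pair 1 1)"
    and "2 \<in> Ess f \<longleftrightarrow> f (pair 0 0) \<noteq> f (pair 0 1) \<or> f (pair 1 0) \<noteq> f (pair 1 1)"
  unfolding Ess_def mem_Collect_eq ex_pair forall_2
  by (auto simp: ex_bit all_bit)

lemma minor_pair:
  fixes f :: "bit ^ 2 \<Rightarrow> bit"
  shows "minor f 1 2 (pair a b) = f (pair b b)" "minor f 2 1 (pair a b) = f (pair a a)"
  by (auto simp: minor_def vec_eq_iff forall_2 intro!: arg_cong[where f = f])

lemma ess_minor:
  fixes f :: "bit ^ 2 \<Rightarrow> bit"
  assumes "i \<noteq> j"
  shows "ess (minor f i j) = (if f (pair 0 0) = f (pair 1 1) then 0 else 1)"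
proof -
  have "i = 1 \<and> j = 2 \<or> i = 2 \<and> j = 1"
    using assms exhaust_2 by metis
  \<comment> \<open>By \<open>minor_pair\<close> the value never depends on coordinate
    \<open>i\<close>, so only \<open>j\<close> can be essential.\<close>
  then have "Ess (minor f i j) = (if f (pair 0 0) = f (pair 1 1) then {} else {j})"
    by (auto simp: set_eq_iff forall_2 mem_Ess_iff minor_pair)
  then show ?thesis
    by (simp add: ess_def)
qed

lemma ess_eq_2_iff:
  fixes f :: "bit ^ 2 \<Rightarrow> bit"
  shows "ess f = 2 \<longleftrightarrow> Ess f = UNIV"
proof
  assume "ess f = 2"
  then show "Ess f = UNIV"
    by (intro card_subset_eq) (simp_all add: ess_def)
qed (simp add: ess_def)

lemma gap_eq:
  fixes f :: "bit ^ 2 \<Rightarrow> bit"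
  assumes "Ess f = UNIV"
  shows "gap f = (if f (pair 0 0) = f (pair 1 1) then 2 else 1)"
proof -
  have "{ess (minor f i j) | i j. i \<in> Ess f \<and> j \<in> Ess f \<and> i \<noteq> j} = {ess (minor f 1 2)}"
  proof -
    have "ess (minor f i j) = ess (minor f 1 2)" if "i \<noteq> j" for i j
      using that by (simp add: ess_minor)
    \<comment> \<open>Guarantees that the set under \<open>Max\<close> is nonempty, hence a
      singleton.\<close>
    moreover have "(1::2) \<noteq> 2"
      by simp
    ultimately show ?thesis
      unfolding assms by blast
  qed
  with assms show ?thesis
    by (simp add: gap_def ess_eq_2_iff[THEN iffD2] ess_minor)
qed

lemma mem_G22_iff:
  "f \<in> G22 \<longleftrightarrow> f (pair 0 0) = f (pair 1 1) \<and>
    (f (pair 0 1) \<noteq> f (pair 0 0) \<or> f (pair 1 0) \<noteq> f (pair 0 0))"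
proof -
  have "f \<in> G22 \<longleftrightarrow> Ess f = UNIV \<and> f (pair 0 0) = f (pair 1 1)"
    by (auto simp: G22_def ess_eq_2_iff gap_eq split: if_splits)
  also have "Ess f = UNIV \<longleftrightarrow> 1 \<in> Ess f \<and> 2 \<in> Ess f"
    by (simp add: set_eq_iff forall_2)
  \<comment> \<open>Once \<open>f\<close> takes the same value c at (0,0) and (1,1), essentiality of
    either variable amounts to the same condition: f(0,1) or f(1,0) differs from c.\<close>
  finally show ?thesis
    by (auto simp: mem_Ess_iff)
qed

theorem theorem3p1:
  fixes f :: "bit ^ 2 \<Rightarrow> bit"
  shows "f \<in> G22 \<longleftrightarrow>
    (\<exists>a0 a1 a2 :: bit. (a1 \<noteq> a0 \<or> a2 \<noteq> a0) \<and>
       f = (\<lambda>x. a0 * (lit (x $ 1) 0 * lit (x $ 2) 0 + lit (x $ 1) 1 * lit (x $ 2) 1)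
              + a1 * (lit (x $ 1) 0 * lit (x $ 2) 1)
              + a2 * (lit (x $ 1) 1 * lit (x $ 2) 0)))"
proof -
  \<comment> \<open>At each point exactly one of the four products of literals is 1, so the formula
    returns the coefficient of that product. The coefficients are therefore forced to be values of
    \<open>f\<close>.\<close>
  have "f = (\<lambda>x. a0 * (lit (x $ 1) 0 * lit (x $ 2) 0 + lit (x $ 1) 1 * lit (x $ 2) 1)
              + a1 * (lit (x $ 1) 0 * lit (x $ 2) 1)
              + a2 * (lit (x $ 1) 1 * lit (x $ 2) 0)) \<longleftrightarrow>
      f (pair 0 0) = a0 \<and> f (pair 1 1) = a0 \<and> f (pair 0 1) = a1 \<and> f (pair 1 0) = a2"
    for a0 a1 a2
    unfolding fun_eq_iff all_pair all_bit pair_nth by (auto simp: lit_def)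
  then show ?thesis
    by (simp only: mem_G22_iff) metis
qed

end
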